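(* The Cesàro operator $C$ on $L^2(0,1)$, defined by $(Cf)(x)=\frac1x\int_0^x\frac{f(t)}{1-t}\,dt$ for $0<x<1$, is normal, i.e. $C^*C=CC^*$.
   Context: $L^2(0,1)$ is the Hilbert space of complex-valued square-integrable functions on $(0,1)$ with respect to Lebesgue measure; $C$ is a bounded linear operator on it and $C^*$ denotes its Hilbert space adjoint. *)

theory Defs
  imports "HOL-Analysis.Analysis"
begin

abbreviation unit_leb :: "real measure" where
  "unit_leb \<equiv> lebesgue_on {0<..<1}"

definition square_int :: "(real \<Rightarrow> complex) \<Rightarrow> bool" where
  "square_int f \<longleftrightarrow>
     f \<in> borel_measurable unit_leb \<and> integrable unit_leb (\<lambda>x. (cmod (f x))\<^sup>2)"

text \<open>
  The elements of $L^2(0,1)$ are classes of Lebesgue measurable, square-integrable functions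
  modulo equality almost everywhere on $(0,1)$; values outside $(0,1)$ are irrelevant.
\<close>

definition L2_rel :: "(real \<Rightarrow> complex) \<Rightarrow> (real \<Rightarrow> complex) \<Rightarrow> bool" where
  "L2_rel f g \<longleftrightarrow> square_int f \<and> square_int g \<and> (AE x in unit_leb. f x = g x)"

lemma square_int_measurable: "square_int f \<Longrightarrow> f \<in> borel_measurable unit_leb"
  by (simp add: square_int_def)

lemma square_int_zero: "square_int (\<lambda>_. 0)"
  by (simp add: square_int_def)

lemma square_int_scale:
  assumes "square_int f" shows "square_int (\<lambda>x. c * f x)"
  using assms unfolding square_int_def by (auto simp: norm_mult power_mult_distrib)

lemma square_int_add:
  assumes "square_int f" "square_int g" shows "square_int (\<lambda>x. f x + g x)"
proof -
  have [measurable]: "f \<in> borel_measurable unit_leb" "g \<in> borel_measurable unit_leb"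
    using assms by (auto simp: square_int_def)
  have "integrable unit_leb (\<lambda>x. 2 * (cmod (f x))\<^sup>2 + 2 * (cmod (g x))\<^sup>2)"
    using assms by (auto simp: square_int_def)
  moreover have "(cmod (f x + g x))\<^sup>2 \<le> 2 * (cmod (f x))\<^sup>2 + 2 * (cmod (g x))\<^sup>2" for x
  proof -
    have "(cmod (f x + g x))\<^sup>2 \<le> (cmod (f x) + cmod (g x))\<^sup>2"
      by (intro power_mono norm_triangle_ineq) simp
    also have "\<dots> \<le> 2 * (cmod (f x))\<^sup>2 + 2 * (cmod (g x))\<^sup>2"
      using sum_squares_bound[of "cmod (f x)" "cmod (g x)"] by (simp add: power2_sum)
    finally show ?thesis .
  qed
  ultimately have "integrable unit_leb (\<lambda>x. (cmod (f x + g x))\<^sup>2)"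
    by (elim Bochner_Integration.integrable_bound) auto
  then show ?thesis by (simp add: square_int_def)
qed

lemma square_int_mult_cnj_integrable:
  assumes "square_int f" "square_int g" shows "integrable unit_leb (\<lambda>x. f x * cnj (g x))"
proof -
  have [measurable]: "f \<in> borel_measurable unit_leb" "g \<in> borel_measurable unit_leb"
    using assms by (auto simp: square_int_def)
  have m: "(\<lambda>x. f x * cnj (g x)) \<in> borel_measurable unit_leb"
    by (intro borel_measurable_times measurable_compose[of g unit_leb borel cnj]
        borel_measurable_continuous_onI continuous_intros) auto
  have "integrable unit_leb (\<lambda>x. (cmod (f x))\<^sup>2 + (cmod (g x))\<^sup>2)"
    using assms by (auto simp: square_int_def)
  moreover have "cmod (f x * cnj (g x)) \<le> (cmod (f x))\<^sup>2 + (cmod (g x))\<^sup>2" for x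
    using sum_squares_bound[of "cmod (f x)" "cmod (g x)"]
      mult_nonneg_nonneg[OF norm_ge_zero[of "f x"] norm_ge_zero[of "g x"]]
    unfolding norm_mult complex_mod_cnj by linarith
  ultimately show ?thesis
    by (elim Bochner_Integration.integrable_bound) (auto simp: m)
qed

lemma part_equivp_L2_rel: "part_equivp L2_rel"
proof (rule part_equivpI)
  show "\<exists>f. L2_rel f f" using square_int_zero by (auto simp: L2_rel_def)
  show "symp L2_rel" by (rule sympI) (auto simp: L2_rel_def elim: eventually_mono)
  show "transp L2_rel"
    by (rule transpI) (auto simp: L2_rel_def elim: eventually_elim2)
qed

quotient_type L2 = "real \<Rightarrow> complex" / partial: L2_rel
  morphisms rep_L2 abs_L2
  by (rule part_equivp_L2_rel)

instantiation L2 :: ab_group_add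
begin

lift_definition zero_L2 :: L2 is "\<lambda>_. 0"
  by (simp add: L2_rel_def square_int_zero)

lift_definition plus_L2 :: "L2 \<Rightarrow> L2 \<Rightarrow> L2" is "\<lambda>f g x. f x + g x"
  by (auto simp: L2_rel_def square_int_add elim: eventually_elim2)

lift_definition uminus_L2 :: "L2 \<Rightarrow> L2" is "\<lambda>f x. - f x"
  using square_int_scale[of _ "-1"] by (auto simp: L2_rel_def elim: eventually_mono)

lift_definition minus_L2 :: "L2 \<Rightarrow> L2 \<Rightarrow> L2" is "\<lambda>f g x. f x - g x"
proof -
  fix f f' g g' assume *: "L2_rel f f'" "L2_rel g g'"
  have "square_int (\<lambda>x. u x - v x)" if "square_int u" "square_int v" for u v
    using square_int_add[OF that(1) square_int_scale[OF that(2), of "-1"]] by simp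
  then show "L2_rel (\<lambda>x. f x - g x) (\<lambda>x. f' x - g' x)"
    using * by (auto simp: L2_rel_def elim: eventually_elim2)
qed

instance
proof
  fix a b c :: L2
  show "a + b + c = a + (b + c)"
    by transfer (auto simp: L2_rel_def add.assoc intro!: square_int_add)
  show "a + b = b + a"
    by transfer (auto simp: L2_rel_def add.commute intro!: square_int_add)
  show "0 + a = a" by transfer (auto simp: L2_rel_def)
  show "- a + a = 0" by transfer (auto simp: L2_rel_def square_int_zero)
  show "a - b = a + - b"
    by transfer
      (use square_int_add square_int_scale[of _ "-1"] in \<open>auto simp: L2_rel_def\<close>, fastforce+)
qed

end

lift_definition cscale :: "complex \<Rightarrow> L2 \<Rightarrow> L2" is "\<lambda>c f x. c * f x"
  by (auto simp: L2_rel_def square_int_scale elim: eventually_mono)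

text \<open>The inner product is linear in its first argument.\<close>

lift_definition cinner :: "L2 \<Rightarrow> L2 \<Rightarrow> complex" is
  "\<lambda>f g. LINT x|unit_leb. f x * cnj (g x)"
proof -
  fix f f' g g' assume *: "L2_rel f f'" "L2_rel g g'"
  then show "(LINT x|unit_leb. f x * cnj (g x)) = (LINT x|unit_leb. f' x * cnj (g' x))"
    by (intro integral_cong_AE)
       (auto simp: L2_rel_def square_int_mult_cnj_integrable borel_measurable_integrable
             elim: eventually_elim2)
qed

lemma cinner_commute: "cinner f g = cnj (cinner g f)"
proof -
  have "cnj (cinner g f) = (LINT x|unit_leb. cnj (rep_L2 g x * cnj (rep_L2 f x)))"
    unfolding cinner.rep_eq by (rule Bochner_Integration.integral_cnj[symmetric])
  then show ?thesis by (simp add: cinner.rep_eq mult.commute)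
qed

lemma cinner_add_left: "cinner (f + g) h = cinner f h + cinner g h"
  by transfer
    (auto simp: L2_rel_def ring_distribs square_int_mult_cnj_integrable)

lemma cinner_cscale_left: "cinner (cscale c f) g = c * cinner f g"
  by transfer (auto simp: mult.assoc)

lemma cinner_self: 
  "cinner f f = complex_of_real (LINT x|unit_leb. (cmod (rep_L2 f x))\<^sup>2)"
proof -
  have "cinner f f = (LINT x|unit_leb. rep_L2 f x * cnj (rep_L2 f x))"
    by (simp add: cinner.rep_eq)
  also have "\<dots> = (LINT x|unit_leb. complex_of_real ((cmod (rep_L2 f x))\<^sup>2))"
    by (simp only: complex_norm_square)
  finally show ?thesis by (simp only: integral_complex_of_real)
qed

lemma square_int_rep_L2: "square_int (rep_L2 f)"
  using Quotient3_rep_reflp[OF Quotient3_L2, of f] by (simp add: L2_rel_def)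

lemma L2_eq_iff: "f = g \<longleftrightarrow> (AE x in unit_leb. rep_L2 f x = rep_L2 g x)"
  using Quotient3_rel_rep[OF Quotient3_L2, of f g] square_int_rep_L2
  by (auto simp: L2_rel_def)

lemma rep_abs_L2:
  "square_int f \<Longrightarrow> AE x in unit_leb. rep_L2 (abs_L2 f) x = f x"
  using Quotient3_rep_abs[OF Quotient3_L2, of f] by (simp add: L2_rel_def)

lemma cinner_self_eq_0_iff: "cinner f f = 0 \<longleftrightarrow> f = 0"
proof -
  have "cinner f f = 0 \<longleftrightarrow> (AE x in unit_leb. (cmod (rep_L2 f x))\<^sup>2 = 0)"
    using square_int_rep_L2[of f]
    by (simp add: cinner_self square_int_def integral_nonneg_eq_0_iff_AE)
  also have "\<dots> \<longleftrightarrow> f = 0"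
    using rep_abs_L2[OF square_int_zero] 
    by (auto simp: L2_eq_iff zero_L2_def elim: eventually_elim2)
  finally show ?thesis .
qed

text \<open>
  The library has no class of complex inner product spaces. The instance below provides the norm
  and topology given by \<^const>\<open>cinner\<close>; its real inner product is the real part of
  \<^const>\<open>cinner\<close>.
\<close>

instantiation L2 :: real_inner
begin

definition scaleR_L2 :: "real \<Rightarrow> L2 \<Rightarrow> L2" where
  "r *\<^sub>R f = cscale (complex_of_real r) f"

definition inner_L2 :: "L2 \<Rightarrow> L2 \<Rightarrow> real" where
  "f \<bullet> g = Re (cinner f g)"

definition norm_L2 :: "L2 \<Rightarrow> real" where
  "norm f = sqrt (Re (cinner f f))"

definition dist_L2 :: "L2 \<Rightarrow> L2 \<Rightarrow> real" where
  "dist_L2 f g = norm (f - g)"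

definition sgn_L2 :: "L2 \<Rightarrow> L2" where
  "sgn_L2 f = inverse (norm f) *\<^sub>R f"

definition uniformity_L2 :: "(L2 \<times> L2) filter" where
  "uniformity_L2 = (INF e\<in>{0 <..}. principal {(x, y). dist x y < e})"

definition open_L2 :: "L2 set \<Rightarrow> bool" where
  "open_L2 U \<longleftrightarrow> (\<forall>x\<in>U. eventually (\<lambda>(x', y). x' = x \<longrightarrow> y \<in> U) uniformity)"

instance
proof
  fix a b :: real and x y z :: L2
  show "a *\<^sub>R (x + y) = a *\<^sub>R x + a *\<^sub>R y" unfolding scaleR_L2_def
    by transfer (auto simp: L2_rel_def ring_distribs intro!: square_int_add square_int_scale)
  show "(a + b) *\<^sub>R x = a *\<^sub>R x + b *\<^sub>R x" unfolding scaleR_L2_def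
  proof transfer
    fix a b :: real and f assume "L2_rel f f"
    then have "square_int f" by (simp add: L2_rel_def)
    then show "L2_rel (\<lambda>x. complex_of_real (a + b) * f x)
        (\<lambda>x. complex_of_real a * f x + complex_of_real b * f x)"
      unfolding L2_rel_def
      by (intro conjI square_int_add square_int_scale) (auto simp: ring_distribs)
  qed
  show "a *\<^sub>R b *\<^sub>R x = (a * b) *\<^sub>R x" unfolding scaleR_L2_def
  proof transfer
    fix a b :: real and f assume "L2_rel f f"
    then have "square_int f" by (simp add: L2_rel_def)
    then show "L2_rel (\<lambda>x. complex_of_real a * (complex_of_real b * f x))
        (\<lambda>x. complex_of_real (a * b) * f x)"
      unfolding L2_rel_def by (intro conjI square_int_scale) (auto simp: mult.assoc)
  qed
  show "1 *\<^sub>R x = x" unfolding scaleR_L2_def by transfer (auto simp: L2_rel_def)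
  show "dist x y = norm (x - y)" by (rule dist_L2_def)
  show "sgn x = inverse (norm x) *\<^sub>R x" by (rule sgn_L2_def)
  show "uniformity = (INF e\<in>{0 <..}. principal {(x :: L2, y). dist x y < e})"
    by (rule uniformity_L2_def)
  show "open U = (\<forall>x\<in>U. eventually (\<lambda>(x', y). x' = x \<longrightarrow> y \<in> U) uniformity)"
    for U :: "L2 set" by (rule open_L2_def)
  show "x \<bullet> y = y \<bullet> x"
    unfolding inner_L2_def by (subst cinner_commute) simp
  show "(x + y) \<bullet> z = x \<bullet> z + y \<bullet> z"
    by (simp add: inner_L2_def cinner_add_left)
  show "(a *\<^sub>R x) \<bullet> y = a * (x \<bullet> y)"
    by (simp add: inner_L2_def scaleR_L2_def cinner_cscale_left)
  show "0 \<le> x \<bullet> x" by (simp add: inner_L2_def cinner_self)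
  show "x \<bullet> x = 0 \<longleftrightarrow> x = 0"
    using cinner_self_eq_0_iff[of x] by (simp add: inner_L2_def cinner_self)
  show "norm x = sqrt (x \<bullet> x)" by (simp add: norm_L2_def inner_L2_def)
qed

end

definition bounded_clinear :: "(L2 \<Rightarrow> L2) \<Rightarrow> bool" where
  "bounded_clinear T \<longleftrightarrow>
     bounded_linear T \<and> (\<forall>c f. T (cscale c f) = cscale c (T f))"

definition is_adjoint :: "(L2 \<Rightarrow> L2) \<Rightarrow> (L2 \<Rightarrow> L2) \<Rightarrow> bool" where
  "is_adjoint T S \<longleftrightarrow> (\<forall>f g. cinner (T f) g = cinner f (S g))"

text \<open>
  An adjoint is unique if it exists, by the lemma below. Since \<^const>\<open>The\<close> is total,
  \<open>normal_operator\<close> also records that the adjoint does exist.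
\<close>

lemma is_adjoint_unique:
  assumes "is_adjoint T S" "is_adjoint T S'" shows "S = S'"
proof
  fix g
  have "(S g - S' g) \<bullet> S g = (S g - S' g) \<bullet> S' g"
    using assms unfolding is_adjoint_def inner_L2_def by metis
  then have "(S g - S' g) \<bullet> (S g - S' g) = 0" by (simp add: inner_diff_right)
  then show "S g = S' g" by simp
qed

definition hilbert_adjoint :: "(L2 \<Rightarrow> L2) \<Rightarrow> L2 \<Rightarrow> L2"  (\<open>_\<^sup>\<star>\<close> [1000] 999) where
  "T\<^sup>\<star> = (THE S. is_adjoint T S)"

lemma hilbert_adjoint_eqI: "is_adjoint T S \<Longrightarrow> T\<^sup>\<star> = S"
  unfolding hilbert_adjoint_def using is_adjoint_unique by blast

definition normal_operator :: "(L2 \<Rightarrow> L2) \<Rightarrow> bool" where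
  "normal_operator T \<longleftrightarrow>
     bounded_clinear T \<and> is_adjoint T (T\<^sup>\<star>) \<and> T\<^sup>\<star> \<circ> T = T \<circ> T\<^sup>\<star>"

definition cesaro_fun :: "(real \<Rightarrow> complex) \<Rightarrow> real \<Rightarrow> complex" where
  "cesaro_fun f x =
     complex_of_real (1 / x) * (LINT t|lebesgue_on {0<..<x}. f t / complex_of_real (1 - t))"

lemma cesaro_fun_integrable:
  assumes "square_int f" "0 < x" "x < 1"
  shows "integrable (lebesgue_on {0<..<x}) (\<lambda>t. f t / complex_of_real (1 - t))"
proof -
  have eq: "lebesgue_on {0<..<x} = restrict_space unit_leb {..<x}"
    using assms by (subst restrict_restrict_space) (auto intro!: arg_cong[where f = lebesgue_on])
  have [measurable]: "f \<in> borel_measurable unit_leb" using assms by (simp add: square_int_def)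
  have [measurable]: "(\<lambda>x. x) \<in> unit_leb \<rightarrow>\<^sub>M borel"
    by (intro measurable_restrict_space1 measurable_completion) simp
  have [measurable]: "{..<x} \<inter> space unit_leb \<in> sets unit_leb"
    by (auto simp: sets_restrict_space_iff)
  interpret finite_measure unit_leb by (rule finite_measure_lebesgue_on) auto
  have "integrable unit_leb (\<lambda>t. (1 + (cmod (f t))\<^sup>2) / (1 - x))"
    using assms by (simp add: square_int_def)
  then have "integrable unit_leb (\<lambda>t. indicator {..<x} t *\<^sub>R (f t / complex_of_real (1 - t)))"
  proof (rule Bochner_Integration.integrable_bound)
    have "cmod (indicator {..<x} t *\<^sub>R (f t / complex_of_real (1 - t)))
        \<le> (1 + (cmod (f t))\<^sup>2) / (1 - x)" for t
    proof (cases "t < x")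
      case True
      have "cmod (f t) \<le> 1 + (cmod (f t))\<^sup>2"
        using sum_squares_bound[of 1 "cmod (f t)"] norm_ge_zero[of "f t"]
        unfolding power_one by linarith
      then have "cmod (f t) / (1 - t) \<le> (1 + (cmod (f t))\<^sup>2) / (1 - x)"
        using True assms by (intro frac_le) auto
      then show ?thesis using True assms by (simp add: norm_divide del: of_real_diff)
    qed (use assms in simp)
    then show "AE t in unit_leb. cmod (indicator {..<x} t *\<^sub>R (f t / complex_of_real (1 - t)))
        \<le> norm ((1 + (cmod (f t))\<^sup>2) / (1 - x))"
      using assms by simp
  qed measurable
  then show ?thesis
    unfolding eq by (subst integrable_restrict_space) (auto simp: sets_restrict_space_iff)
qed

lemma cesaro_fun_unit_leb:
  assumes "0 < x" "x < 1"
  shows "cesaro_fun f x = complex_of_real (1 / x) *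
    (LINT t|unit_leb. indicator {..<x} t *\<^sub>R (f t / complex_of_real (1 - t)))"
proof -
  have "lebesgue_on {0<..<x} = restrict_space unit_leb {..<x}"
  proof -
    have "restrict_space unit_leb {..<x} = lebesgue_on ({0<..<1} \<inter> {..<x})"
      by (rule restrict_restrict_space) auto
    also have "{0<..<1} \<inter> {..<x} = {0<..<x}" using assms by auto
    finally show ?thesis by simp
  qed
  then show ?thesis unfolding cesaro_fun_def
    by (simp add: integral_restrict_space sets_restrict_space_iff)
qed

lemma sigma_finite_unit_leb: "sigma_finite_measure unit_leb"
proof -
  interpret finite_measure unit_leb by (rule finite_measure_lebesgue_on) auto
  show ?thesis by unfold_locales
qed

lemma unit_leb_borel [measurable]: "(\<lambda>x. x) \<in> unit_leb \<rightarrow>\<^sub>M borel"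
  by (intro measurable_restrict_space1 measurable_completion) simp

lemma nn_integral_unit_leb_FTC:
  fixes F g :: "real \<Rightarrow> real"
  assumes ab: "0 \<le> a" "a < b" "b \<le> 1"
    and F: "\<And>x. a < x \<Longrightarrow> x < b \<Longrightarrow> (F has_real_derivative g x) (at x)"
    and g: "\<And>x. a < x \<Longrightarrow> x < b \<Longrightarrow> isCont g x"
    and nonneg: "\<And>x. a < x \<Longrightarrow> x < b \<Longrightarrow> 0 \<le> g x"
    and A: "(F \<longlongrightarrow> A) (at_right a)" and B: "(F \<longlongrightarrow> B) (at_left b)"
  shows "(\<integral>\<^sup>+x. indicator {a<..<b} x * ennreal (g x) \<partial>unit_leb) = ennreal (B - A)"
proof -
  have A': "((F \<circ> real_of_ereal) \<longlongrightarrow> A) (at_right (ereal a))"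
    and B': "((F \<circ> real_of_ereal) \<longlongrightarrow> B) (at_left (ereal b))"
    using A B by (simp_all add: ereal_tendsto_simps)
  have i: "set_integrable lborel {a<..<b} g" and v: "(LBINT x=a..b. g x) = B - A"
    using interval_integral_FTC_nonneg[of "ereal a" "ereal b" F g A B] ab F g nonneg A' B'
    by auto
  have "(\<integral>\<^sup>+x. indicator {a<..<b} x * ennreal (g x) \<partial>unit_leb) =
        (\<integral>\<^sup>+x. indicator {a<..<b} x * ennreal (g x) * indicator {0<..<1} x \<partial>lebesgue)"
    by (simp add: nn_integral_restrict_space)
  also have "\<dots> = (\<integral>\<^sup>+x. ennreal (indicator {a<..<b} x *\<^sub>R g x) \<partial>lebesgue)"
    using ab by (intro nn_integral_cong) (auto simp: indicator_def)
  also have "\<dots> = (\<integral>\<^sup>+x. ennreal (indicator {a<..<b} x *\<^sub>R g x) \<partial>lborel)"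
    by (rule nn_integral_completion)
  also have "\<dots> = ennreal (LBINT x:{a<..<b}. g x)"
    unfolding set_lebesgue_integral_def
    using i nonneg unfolding set_integrable_def
    by (intro nn_integral_eq_integral) (auto simp: indicator_def)
  also have "(LBINT x:{a<..<b}. g x) = B - A"
    using v ab by (simp add: interval_lebesgue_integral_def)
  finally show ?thesis .
qed

definition cesaro_weight :: "real \<Rightarrow> real" where
  "cesaro_weight t = sqrt (t / (1 - t))"

lemma cesaro_weight_pos: "0 < t \<Longrightarrow> t < 1 \<Longrightarrow> 0 < cesaro_weight t"
  by (simp add: cesaro_weight_def)

lemma cesaro_weight_measurable [measurable]: "cesaro_weight \<in> borel_measurable borel"
  unfolding cesaro_weight_def by measurable

lemma cesaro_weight_sq: "0 < t \<Longrightarrow> t < 1 \<Longrightarrow> (cesaro_weight t)\<^sup>2 = t / (1 - t)"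
  by (simp add: cesaro_weight_def)

lemma cesaro_weight_deriv:
  assumes "0 < t" "t < 1"
  shows "(cesaro_weight has_real_derivative 1 / (2 * cesaro_weight t * (1 - t)\<^sup>2)) (at t)"
  unfolding cesaro_weight_def
  by (rule derivative_eq_intros refl | use assms in \<open>simp add: field_simps power2_eq_square\<close>)+

lemma cesaro_weight_cont: "0 < t \<Longrightarrow> t < 1 \<Longrightarrow> isCont cesaro_weight t"
  using cesaro_weight_deriv DERIV_isCont by blast

lemma cesaro_weight_left:
  assumes "0 < x" "x < 1"
  shows "(\<integral>\<^sup>+t. indicator {0<..<x} t * ennreal (1 / (cesaro_weight t * (1 - t)\<^sup>2)) \<partial>unit_leb)
         = ennreal (2 * cesaro_weight x)"
proof -
  have "(\<integral>\<^sup>+t. indicator {0<..<x} t * ennreal (1 / (cesaro_weight t * (1 - t)\<^sup>2)) \<partial>unit_leb)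
         = ennreal (2 * cesaro_weight x - 0)"
  proof (rule nn_integral_unit_leb_FTC[where F = "\<lambda>t. 2 * cesaro_weight t"])
    fix t assume t: "0 < t" "t < x"
    then show "((\<lambda>t. 2 * cesaro_weight t) has_real_derivative
        1 / (cesaro_weight t * (1 - t)\<^sup>2)) (at t)"
      using DERIV_cmult[OF cesaro_weight_deriv, of t 2] assms by simp
    show "isCont (\<lambda>t. 1 / (cesaro_weight t * (1 - t)\<^sup>2)) t"
      using t assms cesaro_weight_pos[of t]
      by (intro continuous_intros cesaro_weight_cont) auto
    show "0 \<le> 1 / (cesaro_weight t * (1 - t)\<^sup>2)"
      using t assms cesaro_weight_pos[of t] by simp
  next
    have "((\<lambda>t. 2 * sqrt (t / (1 - t))) \<longlongrightarrow> 2 * sqrt (0 / (1 - 0))) (at_right 0)"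
      by (intro tendsto_intros) auto
    then show "((\<lambda>t. 2 * cesaro_weight t) \<longlongrightarrow> 0) (at_right 0)"
      by (simp add: cesaro_weight_def)
    have "isCont (\<lambda>t. 2 * cesaro_weight t) x"
      using assms by (intro continuous_intros cesaro_weight_cont)
    then show "((\<lambda>t. 2 * cesaro_weight t) \<longlongrightarrow> 2 * cesaro_weight x) (at_left x)"
      by (simp add: isCont_def filterlim_at_split)
  qed (use assms in auto)
  then show ?thesis by simp
qed

lemma cesaro_weight_right:
  assumes "0 < t" "t < 1"
  shows "(\<integral>\<^sup>+x. indicator {t<..<1} x * ennreal (2 * cesaro_weight x / x\<^sup>2) \<partial>unit_leb)
         = ennreal (4 / cesaro_weight t)"
proof -
  have "(\<integral>\<^sup>+x. indicator {t<..<1} x * ennreal (2 * cesaro_weight x / x\<^sup>2) \<partial>unit_leb)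
         = ennreal (0 - (- 4 / cesaro_weight t))"
  proof (rule nn_integral_unit_leb_FTC[where F = "\<lambda>t. - 4 / cesaro_weight t"])
    fix x assume x: "t < x" "x < 1"
    then have x0: "0 < x" "x < 1" using assms by auto
    note p = cesaro_weight_pos[OF x0]
    have "((\<lambda>t. - 4 / cesaro_weight t) has_real_derivative
        4 * (1 / (2 * cesaro_weight x * (1 - x)\<^sup>2)) / (cesaro_weight x)\<^sup>2) (at x)"
      by (rule derivative_eq_intros cesaro_weight_deriv x0 refl
          | use p in \<open>simp add: power2_eq_square\<close>)+
    also have "4 * (1 / (2 * cesaro_weight x * (1 - x)\<^sup>2)) / (cesaro_weight x)\<^sup>2
        = 2 * cesaro_weight x / ((cesaro_weight x)\<^sup>2 * (cesaro_weight x)\<^sup>2 * (1 - x)\<^sup>2)"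
    proof -
      have "4 * (1 / (2 * w * d)) / w\<^sup>2 = 2 * w / (w\<^sup>2 * w\<^sup>2 * d)" if "0 < w" "0 < d" for w d :: real
        using that by (simp add: divide_simps power2_eq_square)
      from this[OF p, of "(1 - x)\<^sup>2"] show ?thesis using x0 by simp
    qed
    also have "\<dots> = 2 * cesaro_weight x / x\<^sup>2"
    proof -
      have "x / d * (x / d) * d\<^sup>2 = x\<^sup>2" if "0 < d" for d :: real
        using that by (simp add: divide_simps power2_eq_square)
      from this[of "1 - x"] show ?thesis
        using x0 by (simp only: cesaro_weight_sq[OF x0] diff_gt_0_iff_gt)
    qed
    finally show "((\<lambda>t. - 4 / cesaro_weight t) has_real_derivative
        2 * cesaro_weight x / x\<^sup>2) (at x)" .
    show "isCont (\<lambda>x. 2 * cesaro_weight x / x\<^sup>2) x"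
      using x0 by (intro continuous_intros cesaro_weight_cont) auto
    show "0 \<le> 2 * cesaro_weight x / x\<^sup>2" using p by simp
  next
    have "isCont (\<lambda>t. - 4 / cesaro_weight t) t"
      using assms cesaro_weight_pos[of t] by (intro continuous_intros cesaro_weight_cont) auto
    then show "((\<lambda>t. - 4 / cesaro_weight t) \<longlongrightarrow> - 4 / cesaro_weight t) (at_right t)"
      by (simp add: isCont_def filterlim_at_split)
    have "((\<lambda>t. - 4 * sqrt ((1 - t) / t)) \<longlongrightarrow> - 4 * sqrt ((1 - 1) / 1)) (at_left (1::real))"
      by (intro tendsto_intros) auto
    then show "((\<lambda>t. - 4 / cesaro_weight t) \<longlongrightarrow> 0) (at_left 1)"
      by (simp add: cesaro_weight_def real_sqrt_divide)
  qed (use assms in auto)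
  then show ?thesis by simp
qed

lemma cesaro_fun_measurable:
  assumes [measurable]: "f \<in> borel_measurable unit_leb"
  shows "cesaro_fun f \<in> borel_measurable unit_leb"
proof -
  interpret sigma_finite_measure unit_leb by (rule sigma_finite_unit_leb)
  have [measurable]: "fst \<in> unit_leb \<Otimes>\<^sub>M unit_leb \<rightarrow>\<^sub>M borel"
    "snd \<in> unit_leb \<Otimes>\<^sub>M unit_leb \<rightarrow>\<^sub>M borel"
    using measurable_compose[OF measurable_fst unit_leb_borel]
      measurable_compose[OF measurable_snd unit_leb_borel] by auto
  have "(\<lambda>(x, t). if t < x then f t / complex_of_real (1 - t) else 0)
      \<in> borel_measurable (unit_leb \<Otimes>\<^sub>M unit_leb)"
    unfolding case_prod_beta by measurable
  then have "(\<lambda>x. complex_of_real (1 / x) *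
      (LINT t|unit_leb. (if t < x then f t / complex_of_real (1 - t) else 0)))
      \<in> borel_measurable unit_leb"
    by (intro borel_measurable_times borel_measurable_lebesgue_integral) measurable
  then show ?thesis
    by (rule measurable_cong[THEN iffD1, rotated])
       (auto simp: cesaro_fun_unit_leb indicator_def if_distrib
             intro!: arg_cong2[where f = "(*)"] Bochner_Integration.integral_cong)
qed

lemma cesaro_fun_pointwise_bound:
  assumes [measurable]: "f \<in> borel_measurable unit_leb" and x: "0 < x" "x < 1"
  shows "ennreal ((cmod (cesaro_fun f x))\<^sup>2) \<le>
    (\<integral>\<^sup>+t. indicator {0<..<x} t * ennreal ((cmod (f t))\<^sup>2 * cesaro_weight t) \<partial>unit_leb)
      * ennreal (2 * cesaro_weight x / x\<^sup>2)"
proof -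
  define I where
    "I = (LINT t|unit_leb. indicator {..<x} t *\<^sub>R (f t / complex_of_real (1 - t)))"
  define u where "u t = indicator {0<..<x} t * ennreal (cmod (f t) * sqrt (cesaro_weight t))" for t
  define v where "v t = indicator {0<..<x} t * ennreal (1 / (sqrt (cesaro_weight t) * (1 - t)))" for t
  have [measurable]: "u \<in> borel_measurable unit_leb" "v \<in> borel_measurable unit_leb"
    unfolding u_def v_def by measurable
  have "ennreal (cmod I) \<le>
      (\<integral>\<^sup>+t. cmod (indicator {..<x} t *\<^sub>R (f t / complex_of_real (1 - t))) \<partial>unit_leb)"
  proof (cases "integrable unit_leb
      (\<lambda>t. indicator {..<x} t *\<^sub>R (f t / complex_of_real (1 - t)))")
    case True
    then show ?thesis unfolding I_def by (rule integral_norm_bound_ennreal)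
  next
    case False
    then have "I = 0" unfolding I_def by (rule not_integrable_integral_eq)
    then show ?thesis by simp
  qed
  also have "\<dots> = (\<integral>\<^sup>+t. u t * v t \<partial>unit_leb)"
  proof (rule nn_integral_cong)
    fix t assume "t \<in> space unit_leb"
    then have t: "0 < t" "t < 1" by auto
    note p = cesaro_weight_pos[OF t]
    show "ennreal (cmod (indicator {..<x} t *\<^sub>R (f t / complex_of_real (1 - t)))) = u t * v t"
    proof (cases "t < x")
      case True
      have "cmod (indicator {..<x} t *\<^sub>R (f t / complex_of_real (1 - t))) = cmod (f t) / (1 - t)"
        using True t by (simp add: norm_divide del: of_real_diff)
      also have "\<dots> = cmod (f t) * sqrt (cesaro_weight t) * (1 / (sqrt (cesaro_weight t) * (1 - t)))"
        using p by simp
      also have "ennreal \<dots> = u t * v t"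
        using True t p unfolding u_def v_def by (subst ennreal_mult) auto
      finally show ?thesis .
    qed (simp add: u_def)
  qed
  finally have "(ennreal (cmod I))\<^sup>2 \<le> (\<integral>\<^sup>+t. u t * v t \<partial>unit_leb)\<^sup>2"
    by (intro power_mono) auto
  also have "\<dots> \<le> (\<integral>\<^sup>+t. (u t)\<^sup>2 \<partial>unit_leb) * (\<integral>\<^sup>+t. (v t)\<^sup>2 \<partial>unit_leb)"
    by (rule Cauchy_Schwarz_nn_integral) auto
  also have "(\<integral>\<^sup>+t. (u t)\<^sup>2 \<partial>unit_leb) =
    (\<integral>\<^sup>+t. indicator {0<..<x} t * ennreal ((cmod (f t))\<^sup>2 * cesaro_weight t) \<partial>unit_leb)"
    (is "_ = ?U")
  proof (rule nn_integral_cong)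
    fix t assume "t \<in> space unit_leb"
    then have "0 \<le> cesaro_weight t" using cesaro_weight_pos[of t] by auto
    then show "(u t)\<^sup>2 = indicator {0<..<x} t * ennreal ((cmod (f t))\<^sup>2 * cesaro_weight t)"
      by (cases "t \<in> {0<..<x}") (simp_all add: u_def ennreal_power power_mult_distrib)
  qed
  also have "(\<integral>\<^sup>+t. (v t)\<^sup>2 \<partial>unit_leb) =
    (\<integral>\<^sup>+t. indicator {0<..<x} t * ennreal (1 / (cesaro_weight t * (1 - t)\<^sup>2)) \<partial>unit_leb)"
  proof (rule nn_integral_cong)
    fix t assume "t \<in> space unit_leb"
    then have "0 \<le> cesaro_weight t" "0 \<le> 1 / (sqrt (cesaro_weight t) * (1 - t))"
      using cesaro_weight_pos[of t] by auto
    then show "(v t)\<^sup>2 = indicator {0<..<x} t * ennreal (1 / (cesaro_weight t * (1 - t)\<^sup>2))"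
      by (cases "t \<in> {0<..<x}")
         (simp_all add: v_def ennreal_power power_mult_distrib power_divide del: zero_le_divide_iff)
  qed
  also have "\<dots> = ennreal (2 * cesaro_weight x)" using x by (rule cesaro_weight_left)
  finally have *: "ennreal ((cmod I)\<^sup>2) \<le> ?U * ennreal (2 * cesaro_weight x)"
    by (simp add: ennreal_power)
  have "(cmod (cesaro_fun f x))\<^sup>2 = (cmod I)\<^sup>2 * (1 / x\<^sup>2)"
    using x by (simp add: cesaro_fun_unit_leb I_def norm_mult norm_divide power_mult_distrib
        power_divide)
  then have "ennreal ((cmod (cesaro_fun f x))\<^sup>2) = ennreal ((cmod I)\<^sup>2) * ennreal (1 / x\<^sup>2)"
    by (simp flip: ennreal_mult)
  also have "\<dots> \<le> ?U * ennreal (2 * cesaro_weight x) * ennreal (1 / x\<^sup>2)"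
    by (intro mult_right_mono *) simp
  also have "\<dots> = ?U * ennreal (2 * cesaro_weight x / x\<^sup>2)"
    using cesaro_weight_pos[OF x] by (simp add: mult.assoc flip: ennreal_mult)
  finally show ?thesis .
qed

lemma cesaro_fun_bound:
  assumes [measurable]: "f \<in> borel_measurable unit_leb"
  shows "(\<integral>\<^sup>+x. ennreal ((cmod (cesaro_fun f x))\<^sup>2) \<partial>unit_leb)
    \<le> 4 * (\<integral>\<^sup>+x. ennreal ((cmod (f x))\<^sup>2) \<partial>unit_leb)"
proof -
  interpret sigma_finite_measure unit_leb by (rule sigma_finite_unit_leb)
  interpret pair_sigma_finite unit_leb unit_leb by unfold_locales
  have [measurable]: "fst \<in> unit_leb \<Otimes>\<^sub>M unit_leb \<rightarrow>\<^sub>M borel"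
    "snd \<in> unit_leb \<Otimes>\<^sub>M unit_leb \<rightarrow>\<^sub>M borel"
    using measurable_compose[OF measurable_fst unit_leb_borel]
      measurable_compose[OF measurable_snd unit_leb_borel] by auto
  define a where "a t = ennreal ((cmod (f t))\<^sup>2 * cesaro_weight t)" for t
  define b where "b x = ennreal (2 * cesaro_weight x / x\<^sup>2)" for x :: real
  have [measurable]: "a \<in> borel_measurable unit_leb" "b \<in> borel_measurable unit_leb"
    unfolding a_def b_def by measurable
  define k where "k = (\<lambda>(x, t). if t < x then a t * b x else 0)"
  have k [measurable]: "k \<in> borel_measurable (unit_leb \<Otimes>\<^sub>M unit_leb)"
    unfolding k_def case_prod_beta by measurable
  have "(\<integral>\<^sup>+x. ennreal ((cmod (cesaro_fun f x))\<^sup>2) \<partial>unit_leb)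
    \<le> (\<integral>\<^sup>+x. (\<integral>\<^sup>+t. indicator {0<..<x} t * a t \<partial>unit_leb) * b x \<partial>unit_leb)"
    unfolding a_def b_def
    by (intro nn_integral_mono cesaro_fun_pointwise_bound) auto
  also have "\<dots> = (\<integral>\<^sup>+x. (\<integral>\<^sup>+t. k (x, t) \<partial>unit_leb) \<partial>unit_leb)"
  proof (rule nn_integral_cong)
    fix x assume "x \<in> space unit_leb"
    have [measurable]: "{0<..<x} \<inter> space unit_leb \<in> sets unit_leb"
      by (auto simp: sets_restrict_space_iff)
    have "(\<integral>\<^sup>+t. indicator {0<..<x} t * a t \<partial>unit_leb) * b x
        = (\<integral>\<^sup>+t. indicator {0<..<x} t * a t * b x \<partial>unit_leb)"
      by (rule nn_integral_multc[symmetric]) measurable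
    also have "\<dots> = (\<integral>\<^sup>+t. k (x, t) \<partial>unit_leb)"
      by (intro nn_integral_cong) (auto simp: k_def indicator_def)
    finally show "(\<integral>\<^sup>+t. indicator {0<..<x} t * a t \<partial>unit_leb) * b x
        = (\<integral>\<^sup>+t. k (x, t) \<partial>unit_leb)" .
  qed
  also have "\<dots> = (\<integral>\<^sup>+t. (\<integral>\<^sup>+x. k (x, t) \<partial>unit_leb) \<partial>unit_leb)"
    by (rule Fubini[symmetric]) (rule k)
  also have "\<dots> = (\<integral>\<^sup>+t. 4 * ennreal ((cmod (f t))\<^sup>2) \<partial>unit_leb)"
  proof (rule nn_integral_cong)
    fix t assume "t \<in> space unit_leb"
    then have t: "0 < t" "t < 1" by auto
    have [measurable]: "{t<..<1} \<inter> space unit_leb \<in> sets unit_leb"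
      by (auto simp: sets_restrict_space_iff)
    have "(\<integral>\<^sup>+x. k (x, t) \<partial>unit_leb) = (\<integral>\<^sup>+x. a t * (indicator {t<..<1} x * b x) \<partial>unit_leb)"
      by (intro nn_integral_cong) (auto simp: k_def indicator_def)
    also have "\<dots> = a t * (\<integral>\<^sup>+x. indicator {t<..<1} x * b x \<partial>unit_leb)"
      by (rule nn_integral_cmult) measurable
    also have "(\<integral>\<^sup>+x. indicator {t<..<1} x * b x \<partial>unit_leb) = ennreal (4 / cesaro_weight t)"
      unfolding b_def using t by (rule cesaro_weight_right)
    also have "a t * ennreal (4 / cesaro_weight t) = ennreal (4 * (cmod (f t))\<^sup>2)"
      using cesaro_weight_pos[OF t] by (simp add: a_def mult.commute flip: ennreal_mult)
    also have "\<dots> = 4 * ennreal ((cmod (f t))\<^sup>2)" by (simp add: ennreal_mult)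
    finally show "(\<integral>\<^sup>+x. k (x, t) \<partial>unit_leb) = 4 * ennreal ((cmod (f t))\<^sup>2)" .
  qed
  also have "\<dots> = 4 * (\<integral>\<^sup>+t. ennreal ((cmod (f t))\<^sup>2) \<partial>unit_leb)"
    by (rule nn_integral_cmult) measurable
  finally show ?thesis .
qed

lemma square_int_cesaro_fun:
  assumes "square_int f" shows "square_int (cesaro_fun f)"
proof -
  have [measurable]: "f \<in> borel_measurable unit_leb" using assms by (simp add: square_int_def)
  have m [measurable]: "cesaro_fun f \<in> borel_measurable unit_leb"
    by (rule cesaro_fun_measurable) measurable
  have "(\<integral>\<^sup>+x. ennreal ((cmod (f x))\<^sup>2) \<partial>unit_leb) < \<infinity>"
    using assms by (simp add: square_int_def integrable_iff_bounded)
  then have "4 * (\<integral>\<^sup>+x. ennreal ((cmod (f x))\<^sup>2) \<partial>unit_leb) < \<infinity>"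
    by (simp add: ennreal_mult_less_top)
  then have "(\<integral>\<^sup>+x. ennreal ((cmod (cesaro_fun f x))\<^sup>2) \<partial>unit_leb) < \<infinity>"
    using cesaro_fun_bound[of f] by (meson le_less_trans \<open>f \<in> borel_measurable unit_leb\<close>)
  then show ?thesis by (simp add: square_int_def integrable_iff_bounded m)
qed

lemma cesaro_fun_cong_AE:
  assumes "f \<in> borel_measurable unit_leb" "g \<in> borel_measurable unit_leb"
    and "AE t in unit_leb. f t = g t" and "0 < x" "x < 1"
  shows "cesaro_fun f x = cesaro_fun g x"
proof -
  have [measurable]: "{..<x} \<inter> space unit_leb \<in> sets unit_leb"
    by (auto simp: sets_restrict_space_iff)
  note [measurable] = assms(1,2)
  show ?thesis
    unfolding cesaro_fun_unit_leb[OF assms(4,5)]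
    by (intro arg_cong2[where f = "(*)"] refl integral_cong_AE)
       (use assms(3) in \<open>measurable, auto\<close>)
qed

lift_definition cesaro :: "L2 \<Rightarrow> L2" is cesaro_fun
  unfolding L2_rel_def
  by (auto simp: square_int_cesaro_fun square_int_measurable intro!: AE_I2 cesaro_fun_cong_AE)

lemma rep_L2_cesaro:
  "AE x in unit_leb. rep_L2 (cesaro f) x =
     complex_of_real (1 / x) *
       (LINT t|lebesgue_on {0<..<x}. rep_L2 f t / complex_of_real (1 - t))"
proof -
  have "cesaro f = abs_L2 (cesaro_fun (rep_L2 f))" by (simp add: cesaro_def map_fun_def)
  then show ?thesis
    using rep_abs_L2[OF square_int_cesaro_fun[OF square_int_rep_L2[of f]]]
    by (simp only: cesaro_fun_def)
qed

end

theory Submission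
  imports Defs
begin

text \<open>
  The operator \<open>C\<close> is the integral operator with kernel \<open>c(x,t) = 1/(x(1-t))\<close> for \<open>t < x\<close> and
  \<open>0\<close> otherwise. By Fubini's theorem its adjoint \<open>C*\<close> has the kernel \<open>c(t,x)\<close>
  (\<open>is_adjoint_cesaro\<close>). The kernel is invariant under \<open>(x,t) \<mapsto> (1-t,1-x)\<close>, so \<open>C* = R C R\<close> for
  the reflection \<open>(R f)(x) = f(1-x)\<close>, which preserves the measure. This is taken as the
  definition of \<open>C*\<close>, so that its square integrability and measurability are inherited
  from \<open>C\<close>.

  Normality is an identity between kernels. Every section \<open>c(x,\<cdot>)\<close> and \<open>c(\<cdot>,x)\<close> is bounded, so it
  lies in \<open>L\<^sup>2\<close>, and \<open>C f\<close> and \<open>C* f\<close> are evaluated at the point \<open>x\<close> as inner products: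
  \<open>(C f)(x) = \<langle>f, c(x,\<cdot>)\<rangle>\<close> and \<open>(C* f)(x) = \<langle>f, c(\<cdot>,x)\<rangle>\<close>. Hence
  \<open>(C C* f)(x) = \<langle>C* f, c(x,\<cdot>)\<rangle> = \<langle>f, C c(x,\<cdot>)\<rangle>\<close> and
  \<open>(C* C f)(x) = \<langle>C f, c(\<cdot>,x)\<rangle> = \<langle>f, C* c(\<cdot>,x)\<rangle>\<close>,
  and it suffices that \<open>C c(x,\<cdot>) = C* c(\<cdot>,x)\<close>. Integrating \<open>1/(1-t)\<^sup>2\<close> from \<open>0\<close> to \<open>min x y\<close>
  gives \<open>(C c(x,\<cdot>))(y) = 1/(max x y (1 - min x y))\<close> (\<open>cesaro_fun_cesaro_ker\<close>). Replacing \<open>x, y\<close> by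
  \<open>1-x, 1-y\<close> turns \<open>max x y\<close> and \<open>1 - min x y\<close> into each other, so this function is
  reflection symmetric, and conjugating with \<open>R\<close> shows that the other side is the same
  function (\<open>cesaro_adj_fun_cesaro_ker\<close>).
\<close>

section \<open>Reflection of the unit interval\<close>

lemma unit_leb_reflect_measurable [measurable]: "(\<lambda>x. 1 - x) \<in> unit_leb \<rightarrow>\<^sub>M unit_leb"
proof -
  have "(\<lambda>x::real. 1 - x) \<in> lebesgue \<rightarrow>\<^sub>M lebesgue"
    using lebesgue_affine_measurable[of "\<lambda>_::real. -1" 1] by simp
  then show ?thesis
    by (intro measurable_restrict_space2 measurable_restrict_space1) auto
qed

lemma distr_unit_leb_reflect: "distr unit_leb unit_leb (\<lambda>x. 1 - x) = unit_leb"
proof (rule measure_eqI)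
  fix A assume "A \<in> sets (distr unit_leb unit_leb (\<lambda>x. 1 - x))"
  then have A: "A \<in> sets unit_leb" by simp
  have "emeasure (distr unit_leb unit_leb (\<lambda>x. 1 - x)) A
      = emeasure unit_leb ((\<lambda>x. 1 - x) -` A \<inter> {0<..<1})"
    using A by (subst emeasure_distr) auto
  also have "(\<lambda>x. 1 - x) -` A \<inter> {0<..<1} = (\<lambda>x. (-1) *\<^sub>R x + 1) ` A"
  proof -
    have "A \<subseteq> {0<..<1}" using sets.sets_into_space[OF A] by simp
    then show ?thesis by (auto simp: image_iff intro!: bexI[of _ "1 - _"])
  qed
  also have "emeasure unit_leb \<dots> = emeasure lebesgue \<dots>"
    using sets.sets_into_space[OF A] by (intro emeasure_restrict_space) auto
  also have "\<dots> = emeasure lebesgue A"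
    by (subst emeasure_lebesgue_affine) simp
  also have "\<dots> = emeasure unit_leb A"
    using sets.sets_into_space[OF A] by (intro emeasure_restrict_space[symmetric]) auto
  finally show "emeasure (distr unit_leb unit_leb (\<lambda>x. 1 - x)) A = emeasure unit_leb A" .
qed simp

lemma integral_unit_leb_reflect:
  fixes f :: "real \<Rightarrow> complex"
  assumes "f \<in> borel_measurable unit_leb"
  shows "(LINT x|unit_leb. f (1 - x)) = (LINT x|unit_leb. f x)"
  using integral_distr[OF unit_leb_reflect_measurable assms] by (simp add: distr_unit_leb_reflect)

lemma square_int_reflect:
  assumes "square_int f" shows "square_int (\<lambda>x. f (1 - x))"
proof -
  have [measurable]: "f \<in> borel_measurable unit_leb" using assms by (simp add: square_int_def)
  have "integrable (distr unit_leb unit_leb (\<lambda>x. 1 - x)) (\<lambda>x. (cmod (f x))\<^sup>2)"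
    using assms by (simp add: distr_unit_leb_reflect square_int_def)
  then have "integrable unit_leb (\<lambda>x. (cmod (f (1 - x)))\<^sup>2)"
    by (rule integrable_distr[rotated]) simp
  then show ?thesis by (simp add: square_int_def)
qed

lemma AE_unit_leb_reflect:
  assumes "AE x in unit_leb. P x" shows "AE x in unit_leb. P (1 - x)"
proof -
  have "AE x in distr unit_leb unit_leb (\<lambda>x. 1 - x). P x"
    unfolding distr_unit_leb_reflect by (rule assms)
  then show ?thesis by (rule AE_distrD[rotated]) (rule unit_leb_reflect_measurable)
qed

section \<open>The adjoint of the Cesaro operator\<close>

text \<open>
  The adjoint is \<open>(C* g)(t) = 1/(1-t) \<integral>\<^sub>t\<^sup>1 g(x)/x dx\<close>, encoded as the conjugate of
  \<open>C\<close> by the reflection so that the \<open>L\<^sup>2\<close> estimate for \<open>C\<close> applies to it.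
\<close>

definition cesaro_adj_fun :: "(real \<Rightarrow> complex) \<Rightarrow> real \<Rightarrow> complex" where
  "cesaro_adj_fun g t = cesaro_fun (\<lambda>s. g (1 - s)) (1 - t)"

lemma square_int_cesaro_adj_fun:
  "square_int g \<Longrightarrow> square_int (cesaro_adj_fun g)"
  unfolding cesaro_adj_fun_def by (intro square_int_reflect square_int_cesaro_fun)

lemma cesaro_adj_fun_unit_leb:
  assumes [measurable]: "g \<in> borel_measurable unit_leb" and t: "0 < t" "t < 1"
  shows "cesaro_adj_fun g t = complex_of_real (1 / (1 - t)) *
    (LINT x|unit_leb. indicator {t<..} x *\<^sub>R (g x / complex_of_real x))"
proof -
  have [measurable]: "{t<..} \<inter> space unit_leb \<in> sets unit_leb"
    by (auto simp: sets_restrict_space_iff)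
  have "(LINT x|unit_leb. indicator {t<..} x *\<^sub>R (g x / complex_of_real x)) =
    (LINT x|unit_leb. indicator {t<..} (1 - x) *\<^sub>R (g (1 - x) / complex_of_real (1 - x)))"
    by (rule integral_unit_leb_reflect[symmetric]) measurable
  also have "\<dots> = (LINT x|unit_leb. indicator {..<1 - t} x *\<^sub>R (g (1 - x) / complex_of_real (1 - x)))"
    by (intro Bochner_Integration.integral_cong) (auto simp: indicator_def)
  finally show ?thesis using t by (simp add: cesaro_adj_fun_def cesaro_fun_unit_leb)
qed

lift_definition cesaro_adj :: "L2 \<Rightarrow> L2" is cesaro_adj_fun
proof -
  fix f g assume fg: "L2_rel f g"
  then have "square_int (\<lambda>x. f (1 - x))" "square_int (\<lambda>x. g (1 - x))"
    by (auto simp: L2_rel_def square_int_reflect)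
  moreover have "AE x in unit_leb. f (1 - x) = g (1 - x)"
    using fg by (intro AE_unit_leb_reflect[where P = "\<lambda>x. f x = g x"]) (simp add: L2_rel_def)
  ultimately have "cesaro_adj_fun f x = cesaro_adj_fun g x" if "0 < x" "x < 1" for x
    unfolding cesaro_adj_fun_def
    using that by (intro cesaro_fun_cong_AE square_int_measurable) auto
  then show "L2_rel (cesaro_adj_fun f) (cesaro_adj_fun g)"
    using fg by (auto simp: L2_rel_def square_int_cesaro_adj_fun intro!: AE_I2)
qed

lemma cesaro_fun_integrable_unit_leb:
  assumes "square_int f" "0 < x" "x < 1"
  shows "integrable unit_leb (\<lambda>t. indicator {..<x} t *\<^sub>R (f t / complex_of_real (1 - t)))"
proof -
  have "restrict_space unit_leb {..<x} = lebesgue_on ({0<..<1} \<inter> {..<x})"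
    by (rule restrict_restrict_space) auto
  also have "{0<..<1} \<inter> {..<x} = {0<..<x}" using assms by auto
  finally have "integrable (restrict_space unit_leb {..<x}) (\<lambda>t. f t / complex_of_real (1 - t))"
    using cesaro_fun_integrable[OF assms] by simp
  then show ?thesis
    by (subst (asm) integrable_restrict_space) (auto simp: sets_restrict_space_iff)
qed

lemma square_int_cmod: "square_int f \<Longrightarrow> square_int (\<lambda>x. complex_of_real (cmod (f x)))"
  by (auto simp: square_int_def)

text \<open>
  Fubini's theorem for the integrand \<open>f(t) cnj(g(x)) / (x(1-t))\<close> on the triangle \<open>t < x\<close>. It is
  absolutely integrable because \<open>C\<close> applied to \<open>|f|\<close> is again square integrable: after
  integrating over \<open>t\<close>, the absolute value of the integrand becomes \<open>(C|f|)(x) |g(x)|\<close>.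
\<close>

lemma cesaro_fun_adjoint:
  assumes f: "square_int f" and g: "square_int g"
  shows "(LINT x|unit_leb. cesaro_fun f x * cnj (g x)) =
         (LINT t|unit_leb. f t * cnj (cesaro_adj_fun g t))"
proof -
  interpret sigma_finite_measure unit_leb by (rule sigma_finite_unit_leb)
  interpret pair_sigma_finite unit_leb unit_leb by unfold_locales
  have [measurable]: "fst \<in> unit_leb \<Otimes>\<^sub>M unit_leb \<rightarrow>\<^sub>M borel"
    "snd \<in> unit_leb \<Otimes>\<^sub>M unit_leb \<rightarrow>\<^sub>M borel"
    using measurable_compose[OF measurable_fst unit_leb_borel]
      measurable_compose[OF measurable_snd unit_leb_borel] by auto
  have [measurable]: "f \<in> borel_measurable unit_leb" "g \<in> borel_measurable unit_leb"
    using f g by (auto simp: square_int_def)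
  have [measurable]: "(\<lambda>x. cnj (g x)) \<in> borel_measurable unit_leb"
    by (intro measurable_compose[of g unit_leb borel cnj]
        borel_measurable_continuous_onI continuous_intros) auto
  define h where "h x t = (if t < x then f t / complex_of_real (1 - t) *
      (cnj (g x) / complex_of_real x) else 0)" for x t
  have h_int: "(LINT t|unit_leb. h x t) = cesaro_fun f x * cnj (g x)"
    and h_integrable: "integrable unit_leb (h x)"
    and h_norm: "(LINT t|unit_leb. cmod (h x t)) =
      cmod (cesaro_fun (\<lambda>t. complex_of_real (cmod (f t))) x * cnj (g x))"
    if x: "0 < x" "x < 1" for x
  proof -
    have h_eq: "h x = (\<lambda>t. indicator {..<x} t *\<^sub>R (f t / complex_of_real (1 - t)) *
        (cnj (g x) / complex_of_real x))"
      by (auto simp: h_def indicator_def)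
    show "integrable unit_leb (h x)"
      unfolding h_eq using cesaro_fun_integrable_unit_leb[OF f x]
      by (rule integrable_mult_left)
    show "(LINT t|unit_leb. h x t) = cesaro_fun f x * cnj (g x)"
      unfolding h_eq cesaro_fun_unit_leb[OF x] integral_mult_left_zero by simp
    have "(LINT t|unit_leb. cmod (h x t)) =
        (LINT t|unit_leb. cmod (indicator {..<x} t *\<^sub>R (f t / complex_of_real (1 - t)))) *
        (cmod (g x) / x)"
      unfolding h_eq norm_mult integral_mult_left_zero using x by (simp add: norm_divide)
    also have "(LINT t|unit_leb. cmod (indicator {..<x} t *\<^sub>R (f t / complex_of_real (1 - t)))) =
        cmod (LINT t|unit_leb. indicator {..<x} t *\<^sub>R
          (complex_of_real (cmod (f t)) / complex_of_real (1 - t)))" (is "?l = _")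
    proof -
      have "(LINT t|unit_leb. indicator {..<x} t *\<^sub>R
          (complex_of_real (cmod (f t)) / complex_of_real (1 - t))) =
        (LINT t|unit_leb. complex_of_real
          (cmod (indicator {..<x} t *\<^sub>R (f t / complex_of_real (1 - t)))))"
        by (intro Bochner_Integration.integral_cong)
           (auto simp: indicator_def norm_divide simp del: of_real_diff)
      also have "\<dots> = complex_of_real ?l" by (rule integral_complex_of_real)
      finally show ?thesis by (simp add: abs_of_nonneg)
    qed
    finally show "(LINT t|unit_leb. cmod (h x t)) =
        cmod (cesaro_fun (\<lambda>t. complex_of_real (cmod (f t))) x * cnj (g x))"
      using x by (simp add: cesaro_fun_unit_leb norm_mult norm_divide)
  qed
  have h_adj: "(LINT x|unit_leb. h x t) = f t * cnj (cesaro_adj_fun g t)"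
    if t: "0 < t" "t < 1" for t
  proof -
    have "(LINT x|unit_leb. h x t) =
      (LINT x|unit_leb. f t / complex_of_real (1 - t) *
         cnj (indicator {t<..} x *\<^sub>R (g x / complex_of_real x)))"
      by (intro Bochner_Integration.integral_cong) (auto simp: h_def indicator_def)
    also have "\<dots> = f t / complex_of_real (1 - t) *
       cnj (LINT x|unit_leb. indicator {t<..} x *\<^sub>R (g x / complex_of_real x))"
      by (simp only: integral_mult_right_zero Bochner_Integration.integral_cnj)
    finally show ?thesis using t by (simp add: cesaro_adj_fun_unit_leb)
  qed
  have "integrable (unit_leb \<Otimes>\<^sub>M unit_leb) (case_prod h)"
  proof (rule Fubini_integrable)
    show "case_prod h \<in> borel_measurable (unit_leb \<Otimes>\<^sub>M unit_leb)"
      unfolding h_def case_prod_beta by measurable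
    have "integrable unit_leb
        (\<lambda>x. cmod (cesaro_fun (\<lambda>t. complex_of_real (cmod (f t))) x * cnj (g x)))"
      using f g by (intro integrable_norm square_int_mult_cnj_integrable square_int_cesaro_fun
          square_int_cmod)
    then show "integrable unit_leb (\<lambda>x. LINT t|unit_leb. norm (case_prod h (x, t)))"
      by (rule Bochner_Integration.integrable_cong[THEN iffD1, rotated 2]) (auto simp: h_norm)
    show "AE x in unit_leb. integrable unit_leb (\<lambda>t. case_prod h (x, t))"
      using h_integrable by (intro AE_I2) auto
  qed
  then have "(LINT t|unit_leb. LINT x|unit_leb. h x t) = (LINT x|unit_leb. LINT t|unit_leb. h x t)"
    by (rule Fubini_integral)
  moreover have "(LINT x|unit_leb. LINT t|unit_leb. h x t) =
      (LINT x|unit_leb. cesaro_fun f x * cnj (g x))"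
    by (intro Bochner_Integration.integral_cong) (auto simp: h_int)
  moreover have "(LINT t|unit_leb. LINT x|unit_leb. h x t) =
      (LINT t|unit_leb. f t * cnj (cesaro_adj_fun g t))"
    by (intro Bochner_Integration.integral_cong) (auto simp: h_adj)
  ultimately show ?thesis by simp
qed

lemma is_adjoint_cesaro: "is_adjoint cesaro cesaro_adj"
  unfolding is_adjoint_def
  by (intro allI; transfer) (simp add: L2_rel_def cesaro_fun_adjoint)

section \<open>The kernel and the two products\<close>

definition cesaro_ker :: "real \<Rightarrow> real \<Rightarrow> complex" where
  "cesaro_ker x t = (if t < x then complex_of_real (1 / (x * (1 - t))) else 0)"

lemma cesaro_ker_reflect:
  "cesaro_ker (1 - t) (1 - x) = cesaro_ker x t"
  by (simp add: cesaro_ker_def mult.commute)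

text \<open>
  For \<open>t < x\<close> the kernel is at most \<open>1/(x(1-x))\<close>, a bound independent of \<open>t\<close>, although it is
  unbounded on the square.
\<close>

lemma square_int_cesaro_ker:
  assumes x: "0 < x" "x < 1" shows "square_int (cesaro_ker x)"
proof -
  interpret finite_measure unit_leb by (rule finite_measure_lebesgue_on) auto
  have m [measurable]: "cesaro_ker x \<in> borel_measurable unit_leb"
    unfolding cesaro_ker_def[abs_def] by measurable
  have "cmod (cesaro_ker x t) \<le> 1 / (x * (1 - x))" for t
    using x by (auto simp: cesaro_ker_def norm_divide norm_mult abs_mult simp del: of_real_diff
        intro!: frac_le mult_left_mono)
  then have "integrable unit_leb (\<lambda>t. (cmod (cesaro_ker x t))\<^sup>2)"
    by (intro integrable_const_bound[where B = "(1 / (x * (1 - x)))\<^sup>2"] AE_I2)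
       (auto intro: power_mono)
  then show ?thesis using m by (simp add: square_int_def)
qed

lemma cesaro_fun_eq_inner:
  assumes "0 < x" "x < 1"
  shows "cesaro_fun f x = (LINT t|unit_leb. f t * cnj (cesaro_ker x t))"
  unfolding cesaro_fun_unit_leb[OF assms] integral_mult_right_zero[symmetric]
  by (intro Bochner_Integration.integral_cong) (auto simp: cesaro_ker_def indicator_def)

lemma cesaro_adj_fun_eq_inner:
  assumes f: "square_int f" and t: "0 < t" "t < 1"
  shows "cesaro_adj_fun f t = (LINT x|unit_leb. f x * cnj (cesaro_ker x t))"
proof -
  have "f \<in> borel_measurable unit_leb" using f by (simp add: square_int_def)
  then show ?thesis
    unfolding cesaro_adj_fun_unit_leb[OF \<open>f \<in> _\<close> t] integral_mult_right_zero[symmetric]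
    by (intro Bochner_Integration.integral_cong) (auto simp: cesaro_ker_def indicator_def)
qed

lemma square_int_cesaro_ker_swap:
  assumes t: "0 < t" "t < 1" shows "square_int (\<lambda>x. cesaro_ker x t)"
  using square_int_reflect[OF square_int_cesaro_ker[of "1 - t"]] t
  by (simp add: cesaro_ker_reflect)

lemma integral_inverse_square:
  assumes m: "0 < m" "m < 1"
  shows "(LINT t|unit_leb. indicator {..<m} t *\<^sub>R (1 / (1 - t)\<^sup>2)) = m / (1 - m)"
proof -
  have "(\<integral>\<^sup>+t. indicator {0<..<m} t * ennreal (1 / (1 - t)\<^sup>2) \<partial>unit_leb)
      = ennreal (1 / (1 - m) - 1)"
  proof (rule nn_integral_unit_leb_FTC[where F = "\<lambda>t. 1 / (1 - t)"])
    fix t :: real assume t: "0 < t" "t < m"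
    show "((\<lambda>t. 1 / (1 - t)) has_real_derivative 1 / (1 - t)\<^sup>2) (at t)"
      by (rule derivative_eq_intros refl | use t m in \<open>simp add: power2_eq_square\<close>)+
    show "isCont (\<lambda>t. 1 / (1 - t)\<^sup>2) t"
      using t m by (intro continuous_intros) auto
    show "0 \<le> 1 / (1 - t)\<^sup>2" by simp
  next
    have "isCont (\<lambda>t::real. 1 / (1 - t)) 0" "isCont (\<lambda>t::real. 1 / (1 - t)) m"
      using m by (intro continuous_intros; simp)+
    then show "((\<lambda>t::real. 1 / (1 - t)) \<longlongrightarrow> 1) (at_right 0)"
      "((\<lambda>t. 1 / (1 - t)) \<longlongrightarrow> 1 / (1 - m)) (at_left m)"
      by (auto simp: isCont_def filterlim_at_split)
  qed (use m in auto)
  also have "1 / (1 - m) - 1 = m / (1 - m)" using m by (simp add: field_simps)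
  finally have "(\<integral>\<^sup>+t. indicator {0<..<m} t * ennreal (1 / (1 - t)\<^sup>2) \<partial>unit_leb)
      = ennreal (m / (1 - m))" .
  also have "(\<integral>\<^sup>+t. indicator {0<..<m} t * ennreal (1 / (1 - t)\<^sup>2) \<partial>unit_leb) =
      (\<integral>\<^sup>+t. ennreal (indicator {..<m} t *\<^sub>R (1 / (1 - t)\<^sup>2)) \<partial>unit_leb)"
    by (intro nn_integral_cong) (auto simp: indicator_def)
  finally have eq: "(\<integral>\<^sup>+t. ennreal (indicator {..<m} t *\<^sub>R (1 / (1 - t)\<^sup>2)) \<partial>unit_leb)
      = ennreal (m / (1 - m))" .
  have [measurable]: "{..<m} \<inter> space unit_leb \<in> sets unit_leb"
    by (auto simp: sets_restrict_space_iff)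
  show ?thesis
    by (rule integral_eq_nn_integral[THEN trans]) (use m in \<open>auto simp: eq[simplified]\<close>)
qed

text \<open>
  The integrand \<open>c(y,t) c(x,t)\<close> lives on \<open>t < min x y\<close>, where it is \<open>1/(x y (1-t)\<^sup>2)\<close>; the factor
  \<open>min x y\<close> of its integral cancels against \<open>x y = max x y * min x y\<close>.
\<close>

lemma cesaro_fun_cesaro_ker:
  assumes x: "0 < x" "x < 1" and y: "0 < y" "y < 1"
  shows "cesaro_fun (cesaro_ker x) y = complex_of_real (1 / (max x y * (1 - min x y)))"
proof -
  define m where "m = min x y"
  have m: "0 < m" "m < 1" using x y by (auto simp: m_def)
  have "(LINT t|unit_leb. indicator {..<y} t *\<^sub>R (cesaro_ker x t / complex_of_real (1 - t))) =
    (LINT t|unit_leb. complex_of_real (1 / x * (indicator {..<m} t *\<^sub>R (1 / (1 - t)\<^sup>2))))"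
    by (intro Bochner_Integration.integral_cong)
       (auto simp: cesaro_ker_def indicator_def m_def power2_eq_square)
  also have "\<dots> = complex_of_real (1 / x * (m / (1 - m)))"
    unfolding integral_complex_of_real integral_mult_right_zero integral_inverse_square[OF m] ..
  finally have "cesaro_fun (cesaro_ker x) y = complex_of_real (1 / y * (1 / x * (m / (1 - m))))"
    using y by (simp add: cesaro_fun_unit_leb)
  also have "1 / y * (1 / x * (m / (1 - m))) = 1 / (max x y * (1 - m))"
    using x y by (auto simp: m_def min_def max_def divide_simps)
  finally show ?thesis by (simp add: m_def)
qed

text \<open>
  The kernel identity behind normality: the right-hand side is invariant when \<open>x\<close> and \<open>y\<close> are
  both reflected, and the left-hand side is that reflection.
\<close>

lemma cesaro_adj_fun_cesaro_ker:
  assumes x: "0 < x" "x < 1" and y: "0 < y" "y < 1"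
  shows "cesaro_adj_fun (\<lambda>s. cesaro_ker s x) y = cesaro_fun (cesaro_ker x) y"
proof -
  have "(\<lambda>s. cesaro_ker (1 - s) x) = cesaro_ker (1 - x)"
    using cesaro_ker_reflect[of _ "1 - x"] by auto
  then have "cesaro_adj_fun (\<lambda>s. cesaro_ker s x) y = cesaro_fun (cesaro_ker (1 - x)) (1 - y)"
    by (simp add: cesaro_adj_fun_def)
  also have "\<dots> = cesaro_fun (cesaro_ker x) y"
    using x y by (simp add: cesaro_fun_cesaro_ker max_def min_def mult.commute)
  finally show ?thesis .
qed

text \<open>
  Both products are evaluated at \<open>x\<close> as inner products with a section of the kernel; the adjoint
  relation moves the remaining operator onto that section. The conjugations below only serve
  to use the adjoint relation from right to left.
\<close>

lemma cesaro_fun_commute: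
  assumes f: "square_int f" and x: "0 < x" "x < 1"
  shows "cesaro_fun (cesaro_adj_fun f) x = cesaro_adj_fun (cesaro_fun f) x"
proof -
  have "cesaro_fun (cesaro_adj_fun f) x =
      cnj (LINT t|unit_leb. cesaro_ker x t * cnj (cesaro_adj_fun f t))"
    unfolding cesaro_fun_eq_inner[OF x] Bochner_Integration.integral_cnj[symmetric]
    by (simp add: mult.commute)
  also have "\<dots> = cnj (LINT t|unit_leb. cesaro_fun (cesaro_ker x) t * cnj (f t))"
    using f x by (simp add: cesaro_fun_adjoint square_int_cesaro_ker)
  also have "\<dots> = (LINT t|unit_leb. f t * cnj (cesaro_fun (cesaro_ker x) t))"
    unfolding Bochner_Integration.integral_cnj[symmetric] by (simp add: mult.commute)
  also have "\<dots> = (LINT t|unit_leb. f t * cnj (cesaro_adj_fun (\<lambda>s. cesaro_ker s x) t))"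
    using x by (intro Bochner_Integration.integral_cong) (auto simp: cesaro_adj_fun_cesaro_ker)
  also have "\<dots> = (LINT t|unit_leb. cesaro_fun f t * cnj (cesaro_ker t x))"
    using f x by (simp add: cesaro_fun_adjoint square_int_cesaro_ker_swap)
  also have "\<dots> = cesaro_adj_fun (cesaro_fun f) x"
    using f x by (simp add: cesaro_adj_fun_eq_inner square_int_cesaro_fun)
  finally show ?thesis .
qed

lemma cesaro_commute: "cesaro (cesaro_adj f) = cesaro_adj (cesaro f)"
proof transfer
  fix f assume "L2_rel f f"
  then have f: "square_int f" by (simp add: L2_rel_def)
  then have "AE x in unit_leb. cesaro_fun (cesaro_adj_fun f) x = cesaro_adj_fun (cesaro_fun f) x"
    by (intro AE_I2 cesaro_fun_commute) auto
  then show "L2_rel (cesaro_fun (cesaro_adj_fun f)) (cesaro_adj_fun (cesaro_fun f))"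
    using f by (simp add: L2_rel_def square_int_cesaro_fun square_int_cesaro_adj_fun)
qed

section \<open>Boundedness and linearity\<close>

lemma cinner_left_ext:
  assumes "\<And>h. cinner f h = cinner g h" shows "f = g"
proof -
  have "(f - g) \<bullet> (f - g) = 0" using assms unfolding inner_diff_left by (simp add: inner_L2_def)
  then show ?thesis by simp
qed

text \<open>
  Linearity comes for free from the adjoint: both sides have the same inner product with every
  vector, so no linearity of integrals has to be checked again.
\<close>

lemma is_adjoint_add:
  assumes "is_adjoint T S" shows "T (f + g) = T f + T g"
  using assms by (intro cinner_left_ext) (simp add: is_adjoint_def cinner_add_left)

lemma is_adjoint_cscale:
  assumes "is_adjoint T S" shows "T (cscale c f) = cscale c (T f)"
  using assms by (intro cinner_left_ext) (simp add: is_adjoint_def cinner_cscale_left)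

lemma norm_L2_eq: "ennreal ((norm f)\<^sup>2) = (\<integral>\<^sup>+x. ennreal ((cmod (rep_L2 f x))\<^sup>2) \<partial>unit_leb)"
proof -
  have "(norm f)\<^sup>2 = (LINT x|unit_leb. (cmod (rep_L2 f x))\<^sup>2)"
    by (simp add: norm_L2_def cinner_self)
  then show ?thesis
    using square_int_rep_L2[of f] by (simp add: square_int_def nn_integral_eq_integral)
qed

lemma norm_cesaro_le: "norm (cesaro f) \<le> norm f * 2"
proof -
  have "cesaro f = abs_L2 (cesaro_fun (rep_L2 f))" by (simp add: cesaro_def map_fun_def)
  then have "AE x in unit_leb. rep_L2 (cesaro f) x = cesaro_fun (rep_L2 f) x"
    using rep_abs_L2[OF square_int_cesaro_fun[OF square_int_rep_L2[of f]]] by simp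
  then have "ennreal ((norm (cesaro f))\<^sup>2) =
      (\<integral>\<^sup>+x. ennreal ((cmod (cesaro_fun (rep_L2 f) x))\<^sup>2) \<partial>unit_leb)"
    unfolding norm_L2_eq by (intro nn_integral_cong_AE) (auto elim: eventually_mono)
  also have "\<dots> \<le> 4 * ennreal ((norm f)\<^sup>2)"
    unfolding norm_L2_eq
    by (intro cesaro_fun_bound square_int_measurable square_int_rep_L2)
  also have "\<dots> = ennreal ((norm f * 2)\<^sup>2)"
    by (simp add: power_mult_distrib ennreal_mult mult.commute)
  finally have "(norm (cesaro f))\<^sup>2 \<le> (norm f * 2)\<^sup>2" by simp
  then show ?thesis by (rule power2_le_imp_le) simp
qed

lemma bounded_clinear_cesaro: "bounded_clinear cesaro"
  unfolding bounded_clinear_def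
  by (intro conjI allI bounded_linear_intro[where K = 2])
     (simp_all add: is_adjoint_add[OF is_adjoint_cesaro] is_adjoint_cscale[OF is_adjoint_cesaro]
       scaleR_L2_def norm_cesaro_le)

theorem theorem2p12:
  shows "normal_operator cesaro"
  unfolding normal_operator_def hilbert_adjoint_eqI[OF is_adjoint_cesaro]
  by (auto simp: is_adjoint_cesaro bounded_clinear_cesaro cesaro_commute)

end
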